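(* Let $n\ge 2$ and let $f$ be an entire function that preserves nonnegativity of symmetric matrices of order $n$, i.e., $f(A)$ is entrywise nonnegative for every entrywise nonnegative symmetric $A\in\mathbb{R}^{n\times n}$. Then, for each ordered $n$-tuple $(x_1,\ldots,x_n)$ of real numbers with $$x_1>-x_2>x_3>\cdots>(-1)^{n-1}x_n>0,$$ $f$ must satisfy $$f[x_1,\ldots,x_n]\ge 0,$$ and for each $k=1,\ldots,n$, $f$ must satisfy $$f[x_1,\ldots,x_{k-1},x_{k+1},\ldots,x_n]-\Bigl(\sum_{j\ne k}x_j\Bigr)f[x_1,\ldots,x_n]\ge 0.$$
   Context: For an entire $f(z)=\sum_{j\ge0}a_jz^j$ and a square matrix $A$, $f(A)=\sum_{j\ge0}a_jA^j$. Inequalities "$\ge 0$" for complex-valued expressions mean real and nonnegative. For pairwise distinct points, the divided difference of $f$ is defined recursively by $f[x]=f(x)$ and $$f[x_1,\ldots,x_k]=\frac{f[x_2,\ldots,x_k]-f[x_1,\ldots,x_{k-1}]}{x_k-x_1};$$ it is symmetric in its points. *)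

theory Defs
  imports "HOL-Complex_Analysis.Complex_Analysis" "Jordan_Normal_Form.Matrix"
begin

(* f[x_1,...,x_k] for the list of points [x_1,...,x_k]. Only nonempty lists of pairwise
   distinct points are meaningful; the value at the empty list is a dummy. *)
fun divdiff :: "('a::field \<Rightarrow> 'a) \<Rightarrow> 'a list \<Rightarrow> 'a" where
  "divdiff f [] = 0"
| "divdiff f [x] = f x"
| "divdiff f (x # y # zs) =
     (divdiff f (y # zs) - divdiff f (butlast (x # y # zs))) / (last (y # zs) - x)"

(* The entrywise sum of the series of a_k A^k, where the a_k are the Taylor coefficients
   of f at 0. The series converges for every square A when f is entire. *)
definition entire_mat :: "(complex \<Rightarrow> complex) \<Rightarrow> complex mat \<Rightarrow> complex mat" where
  "entire_mat f A = Matrix.mat (dim_row A) (dim_row A)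
     (\<lambda>(i, j). \<Sum>k. fps_nth (fps_expansion f 0) k * ((A ^\<^sub>m k) $$ (i, j)))"

(* The condition "z in nonneg_Reals" for complex z says that z is real and nonnegative. *)
definition preserves_nonneg_symmetric :: "nat \<Rightarrow> (complex \<Rightarrow> complex) \<Rightarrow> bool" where
  "preserves_nonneg_symmetric n f \<longleftrightarrow>
     (\<forall>A :: real mat. A \<in> carrier_mat n n \<longrightarrow> transpose_mat A = A \<longrightarrow>
        (\<forall>i<n. \<forall>j<n. A $$ (i, j) \<ge> 0) \<longrightarrow>
        (\<forall>i<n. \<forall>j<n. entire_mat f (map_mat complex_of_real A) $$ (i, j) \<in> \<real>\<^sub>\<ge>\<^sub>0))"

end

theory Submission
  imports Defs "Jordan_Normal_Form.Determinant"
begin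

text \<open>Put \<open>y\<^sub>c = x\<^sub>c\<^sub>+\<^sub>1\<close> and weight the nodes by
  \<open>1 / (y\<^sub>c \<Prod>\<^sub>j\<^sub>\<noteq>\<^sub>c (y\<^sub>c\<^sup>2 - y\<^sub>j\<^sup>2))\<close>, which the alternation makes positive. By Lagrange
  interpolation in the squares, the odd moments of degree below \<open>2n - 1\<close> vanish and the one of
  degree \<open>2n - 1\<close> is 1. Hence multiplication by \<open>t\<close>, written in the orthonormal polynomials of
  this weight, is a nonnegative tridiagonal symmetric matrix \<open>J\<close> with spectrum \<open>{x\<^sub>1, \<dots>, x\<^sub>n}\<close> whose
  only nonzero diagonal entry is the last. If \<open>P\<close> is the interpolant of \<open>f\<close> of degree below \<open>n\<close>, then
  the last two entries of the first row of \<open>f(J) = P(J)\<close> are positive multiples of the coefficients of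
  \<open>P\<close> at \<open>n - 2\<close> and \<open>n - 1\<close>, and these are the two expressions of the theorem.\<close>

section \<open>Interpolation, and divided differences as coefficients of the interpolant\<close>

definition root_poly :: "'a::field list \<Rightarrow> 'a poly" where
  "root_poly xs = (\<Prod>z\<leftarrow>xs. [:- z, 1:])"

lemma poly_root_poly: "poly (root_poly xs) z = (\<Prod>t\<leftarrow>xs. z - t)"
  by (induction xs) (auto simp: root_poly_def algebra_simps)

lemma poly_root_poly_eq_0_iff: "poly (root_poly xs) z = 0 \<longleftrightarrow> z \<in> set xs"
  by (auto simp: poly_root_poly prod_list_zero_iff)

lemma degree_root_poly: "degree (root_poly xs) = length xs"
  and lead_coeff_root_poly: "coeff (root_poly xs) (length xs) = 1"
proof -
  have "degree (root_poly xs) = length xs \<and> lead_coeff (root_poly xs) = 1"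
  proof (induction xs)
    case (Cons a xs)
    then have "root_poly xs \<noteq> 0" by auto
    then show ?case
      using Cons degree_mult_eq[of "[:-a,1:]" "root_poly xs"] lead_coeff_mult[of "[:-a,1:]" "root_poly xs"]
      by (auto simp: root_poly_def simp del: mult_pCons_left)
  qed (auto simp: root_poly_def)
  then show "degree (root_poly xs) = length xs" "coeff (root_poly xs) (length xs) = 1"
    by auto
qed

lemma subleading_coeff_root_poly:
  assumes "xs \<noteq> []"
  shows "coeff (root_poly xs) (length xs - 1) = - sum_list xs"
  using assms
proof (induction xs rule: list_nonempty_induct)
  case (cons a xs)
  then obtain m where m: "length xs = Suc m" by (cases xs) auto
  have "root_poly (a # xs) = Polynomial.smult (- a) (root_poly xs) + pCons 0 (root_poly xs)"
    by (simp add: root_poly_def)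
  then show ?case
    using cons m lead_coeff_root_poly[of xs] by simp
qed (simp add: root_poly_def)

lemma interpolation_exists:
  fixes f :: "'a::field \<Rightarrow> 'a"
  assumes "distinct xs" "xs \<noteq> []"
  shows "\<exists>P. degree P < length xs \<and> (\<forall>z\<in>set xs. poly P z = f z)"
  using assms(2,1)
proof (induction xs rule: list_nonempty_induct)
  case (single a)
  show ?case by (rule exI[of _ "[:f a:]"]) simp
next
  case (cons a xs)
  then obtain P where P: "degree P < length xs" "\<forall>z\<in>set xs. poly P z = f z" by auto
  \<comment> \<open>Newton's step: adding a multiple of \<open>root_poly xs\<close> leaves the
    values on \<open>xs\<close> alone, and this factor corrects the value at
    \<open>a\<close>.\<close>
  define c where "c = (f a - poly P a) / poly (root_poly xs) a"
  have "poly (root_poly xs) a \<noteq> 0"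
    using cons by (auto simp: poly_root_poly_eq_0_iff)
  moreover have "degree (P + Polynomial.smult c (root_poly xs)) \<le> length xs"
    using P degree_root_poly[of xs]
    by (intro degree_add_le) (auto intro: order.trans[OF degree_smult_le])
  moreover have "poly (root_poly xs) z = 0" if "z \<in> set xs" for z
    using that by (simp add: poly_root_poly_eq_0_iff)
  ultimately show ?case
    using P by (intro exI[of _ "P + Polynomial.smult c (root_poly xs)"]) (auto simp: c_def)
qed

text \<open>Reduction modulo the monic \<open>root_poly xs\<close>; one subtraction suffices, and
  the subleading coefficient \<open>- sum_list xs\<close> of the divisor causes the shift. This
  describes what happens to an interpolant when one point is dropped.\<close>

lemma divide_by_root_poly:
  fixes P :: "'a::field poly"
  assumes "xs \<noteq> []" "degree P \<le> length xs" "\<forall>z\<in>set xs. poly P z = f z"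
  obtains R where "degree R < length xs" "\<forall>z\<in>set xs. poly R z = f z"
    "coeff R (length xs - 1) = coeff P (length xs - 1) + coeff P (length xs) * sum_list xs"
proof -
  let ?R = "P - Polynomial.smult (coeff P (length xs)) (root_poly xs)"
  obtain m where m: "length xs = Suc m" using assms by (cases xs) auto
  have "degree ?R \<le> m"
  proof (rule degree_le, intro allI impI)
    fix i assume "m < i"
    then consider "i = length xs" | "i > length xs" using m by linarith
    then show "coeff ?R i = 0"
      using assms(2) lead_coeff_root_poly[of xs] degree_root_poly[of xs]
      by cases (auto simp: coeff_eq_0)
  qed
  then have "degree ?R < length xs" by (simp add: m)
  moreover have "\<forall>z\<in>set xs. poly ?R z = f z"
    using assms(3) by (auto simp: poly_root_poly_eq_0_iff)
  moreover have "coeff ?R (length xs - 1) = coeff P (length xs - 1) + coeff P (length xs) * sum_list xs"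
    using subleading_coeff_root_poly[OF assms(1)] by simp
  ultimately show ?thesis by (rule that)
qed

text \<open>Dropping the first or the last point reduces \<open>P\<close> by
  \<open>divide_by_root_poly\<close>. The two new coefficients differ by the top coefficient of
  \<open>P\<close> times the difference of the point sums, and that difference is the denominator in
  the recursion.\<close>

lemma divdiff_eq_coeff:
  assumes "distinct xs" "xs \<noteq> []" "degree P < length xs" "\<forall>z\<in>set xs. poly P z = f z"
  shows "divdiff f xs = coeff P (length xs - 1)"
  using assms
proof (induction f xs arbitrary: P rule: divdiff.induct)
  case (2 f x)
  then obtain c where "P = [:c:]" by (auto elim: degree_eq_zeroE)
  then show ?case using 2 by simp
next
  case (3 f x y zs)
  let ?t = "y # zs" and ?i = "butlast (x # y # zs)"
  have len: "length ?i = Suc (length zs)" by simp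
  have sub: "set ?i \<subseteq> set (x # y # zs)" by (meson in_set_butlastD subsetI)
  have dist: "distinct ?i" using "3.prems"(1) distinct_butlast by blast
  obtain R where R: "degree R < length ?t" "\<forall>z\<in>set ?t. poly R z = f z"
    "coeff R (length ?t - 1) = coeff P (length ?t - 1) + coeff P (length ?t) * sum_list ?t"
    using divide_by_root_poly[of ?t P f] "3.prems" by auto
  obtain S where S: "degree S < length ?i" "\<forall>z\<in>set ?i. poly S z = f z"
    "coeff S (length ?i - 1) = coeff P (length ?i - 1) + coeff P (length ?i) * sum_list ?i"
    using divide_by_root_poly[of ?i P f] "3.prems" sub len
    by (metis (no_types, lifting) length_Cons less_Suc_eq_le list.size(3) nat.distinct(1) subsetD)
  have "divdiff f ?t = coeff P (length zs) + coeff P (Suc (length zs)) * sum_list ?t"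
    using "3.IH"(1)[of R] R "3.prems" by simp
  moreover have "divdiff f ?i = coeff P (length zs) + coeff P (Suc (length zs)) * sum_list ?i"
    using "3.IH"(2)[OF dist _ S(1,2)] S(3) len by simp
  moreover have "sum_list ?t - sum_list ?i = last ?t - x"
  proof -
    have "sum_list (x # y # zs) = sum_list (?i @ [last ?t])"
      by (metis append_butlast_last_id last_ConsR list.distinct(1))
    then show ?thesis by (simp only: sum_list_append sum_list.Cons sum_list.Nil) (simp add: algebra_simps)
  qed
  ultimately have "divdiff f ?t - divdiff f ?i = coeff P (Suc (length zs)) * (last ?t - x)"
    by (simp add: right_diff_distrib[symmetric] del: sum_list.Cons butlast.simps)
  moreover have "last ?t - x \<noteq> 0"
    using "3.prems"(1) last_in_set[of ?t] by (auto simp del: last.simps)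
  ultimately show ?case by simp
qed simp

section \<open>Entire functions of a matrix with known orthonormal eigenvectors\<close>

lemma spectral_power_entry:
  fixes n :: nat and d :: "nat \<Rightarrow> 'a::field" and U :: "nat \<Rightarrow> nat \<Rightarrow> 'a"
  defines "A \<equiv> Matrix.mat n n (\<lambda>(i, j). \<Sum>c<n. d c * U i c * U j c)"
  assumes orth: "\<And>i j. i < n \<Longrightarrow> j < n \<Longrightarrow> (\<Sum>c<n. U i c * U j c) = (if i = j then 1 else 0)"
    and "i < n" "j < n"
  shows "(A ^\<^sub>m m) $$ (i, j) = (\<Sum>c<n. d c ^ m * U i c * U j c)"
proof -
  let ?Q = "Matrix.mat n n (\<lambda>(i, c). U i c)"
  have car: "?Q \<in> carrier_mat n n" "transpose_mat ?Q \<in> carrier_mat n n" by auto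
  \<comment> \<open>A one-sided inverse of a square matrix is two-sided, so the orthonormal rows
    yield the orthonormal columns needed for multiplying powers.\<close>
  have "?Q * transpose_mat ?Q = 1\<^sub>m n"
    by (rule eq_matI) (auto simp: scalar_prod_def orth lessThan_atLeast0[symmetric])
  then have QTQ: "transpose_mat ?Q * ?Q = 1\<^sub>m n"
    using mat_mult_left_right_inverse[OF car] by simp
  have col: "(\<Sum>i<n. U i c * U i e) = (if c = e then 1 else 0)" if "c < n" "e < n" for c e
    using that arg_cong[OF QTQ, of "\<lambda>M. M $$ (c, e)"]
    by (simp add: scalar_prod_def lessThan_atLeast0[symmetric])
  have A: "A \<in> carrier_mat n n" by (simp add: A_def)
  show ?thesis using assms(3,4)
  proof (induction m arbitrary: i j)
    case 0
    then show ?case using A orth by simp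
  next
    case (Suc m)
    have "(A ^\<^sub>m Suc m) $$ (i, j) = (\<Sum>k<n. (A ^\<^sub>m m) $$ (i, k) * A $$ (k, j))"
      using Suc.prems A pow_carrier_mat[OF A, of m]
      by (simp add: scalar_prod_def lessThan_atLeast0[symmetric])
    also have "\<dots> = (\<Sum>k<n. (\<Sum>c<n. d c ^ m * U i c * U k c) * (\<Sum>e<n. d e * U k e * U j e))"
      using Suc by (intro sum.cong) (auto simp: A_def)
    also have "\<dots> = (\<Sum>k<n. \<Sum>c<n. \<Sum>e<n. d c ^ m * U i c * d e * U j e * (U k c * U k e))"
      unfolding sum_product by (intro sum.cong refl) (simp add: mult_ac)
    \<comment> \<open>With the sum over \<open>k\<close> innermost, \<open>col\<close> collapses the
      double sum to its diagonal.\<close>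
    also have "\<dots> = (\<Sum>c<n. \<Sum>e<n. \<Sum>k<n. d c ^ m * U i c * d e * U j e * (U k c * U k e))"
      by (subst sum.swap) (rule sum.cong[OF refl], rule sum.swap)
    also have "\<dots> = (\<Sum>c<n. \<Sum>e<n. d c ^ m * U i c * d e * U j e * (if c = e then 1 else 0))"
      by (intro sum.cong refl) (simp add: sum_distrib_left[symmetric] col)
    also have "\<dots> = (\<Sum>c<n. d c ^ Suc m * U i c * U j c)"
      by (intro sum.cong refl) (simp add: if_distrib[of "\<lambda>t. _ * t"] sum.delta mult_ac cong: if_cong)
    finally show ?case .
  qed
qed

text \<open>The Taylor series of \<open>f\<close> at 0 converges to \<open>f\<close> at every
  \<open>d c\<close>, and an entry of the matrix series is a finite linear combination of these
  series.\<close>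

lemma entire_mat_spectral:
  fixes n :: nat and d :: "nat \<Rightarrow> complex" and U :: "nat \<Rightarrow> nat \<Rightarrow> complex"
  defines "A \<equiv> Matrix.mat n n (\<lambda>(i, j). \<Sum>c<n. d c * U i c * U j c)"
  assumes f: "f holomorphic_on UNIV"
    and orth: "\<And>i j. i < n \<Longrightarrow> j < n \<Longrightarrow> (\<Sum>c<n. U i c * U j c) = (if i = j then 1 else 0)"
    and ij: "i < n" "j < n"
  shows "entire_mat f A $$ (i, j) = (\<Sum>c<n. U i c * U j c * f (d c))"
proof -
  have s: "(\<lambda>k. fps_nth (fps_expansion f 0) k * z ^ k) sums f z" for z
    using holomorphic_power_series[of f 0 "norm z + 1" z] holomorphic_on_subset[OF f]
    by (auto simp: fps_expansion_def dist_norm)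
  have "(\<lambda>k. \<Sum>c<n. U i c * U j c * (fps_nth (fps_expansion f 0) k * d c ^ k))
          sums (\<Sum>c<n. U i c * U j c * f (d c))"
    by (intro sums_sum sums_mult s)
  moreover have "fps_nth (fps_expansion f 0) k * ((A ^\<^sub>m k) $$ (i, j)) =
      (\<Sum>c<n. U i c * U j c * (fps_nth (fps_expansion f 0) k * d c ^ k))" for k
  proof -
    have "(A ^\<^sub>m k) $$ (i, j) = (\<Sum>c<n. d c ^ k * U i c * U j c)"
      unfolding A_def by (rule spectral_power_entry) (use orth ij in auto)
    then show ?thesis by (simp add: sum_distrib_left mult_ac)
  qed
  ultimately have "(\<Sum>k. fps_nth (fps_expansion f 0) k * ((A ^\<^sub>m k) $$ (i, j))) =
      (\<Sum>c<n. U i c * U j c * f (d c))"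
    by (simp add: sums_iff)
  then show ?thesis using ij by (simp add: entire_mat_def A_def)
qed

section \<open>Lagrange power sums, alternating nodes and positive weights\<close>

lemma power_sum_lagrange:
  fixes z :: "nat \<Rightarrow> 'a::field"
  assumes "inj_on z {..<n}" "i < n"
  shows "(\<Sum>c<n. z c ^ i / (\<Prod>j\<in>{..<n} - {c}. z c - z j)) = (if i = n - 1 then 1 else 0)"
proof -
  let ?B = "\<lambda>c. \<Prod>j\<in>{..<n} - {c}. [:- z j, 1:]"
  let ?D = "\<lambda>c. \<Prod>j\<in>{..<n} - {c}. z c - z j"
  have deg: "degree (?B c) = n - 1" if "c < n" for c
    using that by (subst degree_prod_sum_eq) auto
  have lc: "coeff (?B c) (n - 1) = 1" if "c < n" for c
    using lead_coeff_prod[of "\<lambda>j. [:- z j, 1:]" "{..<n} - {c}"] deg[OF that] by simp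
  have eval: "poly (?B c) (z e) = (if c = e then ?D c else 0)" if "e < n" "c < n" for c e
    using that by (auto simp: poly_prod intro!: prod_zero)
  have D: "?D c \<noteq> 0" if "c < n" for c
    using that assms(1) by (auto simp: prod_zero_iff inj_on_def)
  let ?P = "\<Sum>c<n. Polynomial.smult (z c ^ i / ?D c) (?B c)"
  \<comment> \<open>Having degree below \<open>n\<close>, the monomial is its own Lagrange
    interpolant. The basis polynomials \<open>?B c\<close> are monic of degree \<open>n - 1\<close>,
    so comparing coefficients there gives the power sum.\<close>
  have "monom 1 i = ?P"
  proof (rule poly_eqI_degree)
    show "poly (monom 1 i) x = poly ?P x" if x: "x \<in> z ` {..<n}" for x
    proof -
      obtain e where e: "x = z e" "e < n" using x by auto
      have "poly ?P x = (\<Sum>c<n. z c ^ i / ?D c * (if c = e then ?D c else 0))"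
        unfolding e(1) poly_sum poly_smult
        using e by (intro sum.cong refl) (auto simp only: eval lessThan_iff)
      also have "\<dots> = z e ^ i"
        using e D[of e] by (simp add: if_distrib[of "\<lambda>t. _ * t"] cong: if_cong)
      finally show ?thesis by (simp add: poly_monom e)
    qed
    have card: "card (z ` {..<n}) = n" using assms(1) by (simp add: card_image)
    show "degree (monom (1::'a) i) < card (z ` {..<n})"
      using assms(2) by (simp add: card degree_monom_eq)
    have "degree ?P \<le> n - 1"
      by (intro degree_sum_le) (auto intro: order.trans[OF degree_smult_le] simp: deg)
    then show "degree ?P < card (z ` {..<n})" using card assms(2) by simp
  qed
  then have "coeff (monom 1 i) (n - 1) = coeff ?P (n - 1)" by simp
  also have "\<dots> = (\<Sum>c<n. z c ^ i / ?D c)"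
    unfolding coeff_sum coeff_smult by (intro sum.cong refl) (simp only: lc lessThan_iff mult_1_right)
  finally show ?thesis by (simp add: eq_commute)
qed

locale alternating_nodes =
  fixes n :: nat and y :: "nat \<Rightarrow> real"
  assumes two_le: "2 \<le> n"
    and alternating: "Suc c < n \<Longrightarrow> (- 1) ^ Suc c * y (Suc c) < (- 1) ^ c * y c"
    and last_pos: "0 < (- 1) ^ (n - 1) * y (n - 1)"
begin

lemma signed_decreasing: "c < e \<Longrightarrow> e < n \<Longrightarrow> (- 1) ^ e * y e < (- 1) ^ c * y c"
proof (induction e)
  case (Suc e)
  then have "(- 1) ^ e * y e \<le> (- 1) ^ c * y c" by (cases "c = e") auto
  then show ?case using alternating[of e] Suc.prems by simp
qed simp

lemma signed_pos:
  assumes "c < n"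
  shows "0 < (- 1) ^ c * y c"
proof (cases "c = n - 1")
  case False
  then have "c < n - 1" "n - 1 < n" using assms by auto
  from signed_decreasing[OF this] last_pos show ?thesis by linarith
qed (use last_pos in simp)

lemma nodes_nonzero: "c < n \<Longrightarrow> y c \<noteq> 0"
  using signed_pos[of c] by auto

lemma squares_decreasing:
  assumes "c < e" "e < n"
  shows "(y e)\<^sup>2 < (y c)\<^sup>2"
proof -
  have "((- 1) ^ e * y e)\<^sup>2 < ((- 1) ^ c * y c)\<^sup>2"
    using signed_decreasing[OF assms] signed_pos[OF assms(2)] by (intro power_strict_mono) auto
  then show ?thesis by (simp add: power_mult_distrib power_mult[symmetric] mult.commute[of _ 2])
qed

lemma inj_squares: "inj_on (\<lambda>c. (y c)\<^sup>2) {..<n}"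
  by (rule linorder_inj_onI') (use squares_decreasing in fastforce)

lemma inj_nodes: "inj_on y {..<n}"
  using inj_squares by (auto simp: inj_on_def)

definition weight :: "nat \<Rightarrow> real" where
  "weight c = 1 / (y c * (\<Prod>j\<in>{..<n} - {c}. (y c)\<^sup>2 - (y j)\<^sup>2))"

text \<open>The squares decrease, so exactly the \<open>c\<close> factors with \<open>j < c\<close>
  are negative; their sign \<open>(- 1) ^ c\<close> is also the sign of \<open>y c\<close>.\<close>

lemma weight_pos:
  assumes c: "c < n"
  shows "0 < weight c"
proof -
  have "{..<n} - {c} = {..<c} \<union> {c<..<n}" using c by auto
  then have "(\<Prod>j\<in>{..<n} - {c}. (y c)\<^sup>2 - (y j)\<^sup>2) =
      (\<Prod>j<c. (y c)\<^sup>2 - (y j)\<^sup>2) * (\<Prod>j\<in>{c<..<n}. (y c)\<^sup>2 - (y j)\<^sup>2)"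
    by (simp add: prod.union_disjoint disjoint_iff)
  also have "(\<Prod>j<c. (y c)\<^sup>2 - (y j)\<^sup>2) = (\<Prod>j<c. - 1 * ((y j)\<^sup>2 - (y c)\<^sup>2))"
    by simp
  also have "\<dots> = (- 1) ^ c * (\<Prod>j<c. (y j)\<^sup>2 - (y c)\<^sup>2)"
    unfolding prod.distrib by simp
  finally have "y c * (\<Prod>j\<in>{..<n} - {c}. (y c)\<^sup>2 - (y j)\<^sup>2) =
      ((- 1) ^ c * y c) * ((\<Prod>j<c. (y j)\<^sup>2 - (y c)\<^sup>2) * (\<Prod>j\<in>{c<..<n}. (y c)\<^sup>2 - (y j)\<^sup>2))"
    by simp
  moreover have "0 < (\<Prod>j<c. (y j)\<^sup>2 - (y c)\<^sup>2)"
    using squares_decreasing c by (intro prod_pos) auto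
  moreover have "0 < (\<Prod>j\<in>{c<..<n}. (y c)\<^sup>2 - (y j)\<^sup>2)"
    using squares_decreasing by (intro prod_pos) auto
  ultimately show ?thesis
    using signed_pos[OF c] by (simp only: weight_def zero_less_divide_1_iff zero_less_mult_iff) auto
qed

section \<open>The weighted functional and its odd moments\<close>

definition functional :: "real poly \<Rightarrow> real" where
  "functional g = (\<Sum>c<n. weight c * poly g (y c))"

lemma functional_add: "functional (g + h) = functional g + functional h"
  and functional_diff: "functional (g - h) = functional g - functional h"
  and functional_smult: "functional (Polynomial.smult a g) = a * functional g"
  by (simp_all add: functional_def sum.distrib sum_subtractf sum_distrib_left algebra_simps)

text \<open>The factor \<open>y c\<close> in the weight cancels one power of the node and leaves a
  power sum in the squares.\<close>

lemma odd_moment: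
  assumes "i < n"
  shows "functional (monom 1 (2 * i + 1)) = (if i = n - 1 then 1 else 0)"
proof -
  have "functional (monom 1 (2 * i + 1)) =
      (\<Sum>c<n. ((y c)\<^sup>2) ^ i / (\<Prod>j\<in>{..<n} - {c}. (y c)\<^sup>2 - (y j)\<^sup>2))"
    unfolding functional_def weight_def
    by (intro sum.cong refl) (use nodes_nonzero in \<open>auto simp: poly_monom power_mult\<close>)
  then show ?thesis using power_sum_lagrange[OF inj_squares assms] by simp
qed

lemma functional_odd:
  assumes odd: "\<And>x. poly g (- x) = - poly g x" and deg: "degree g \<le> 2 * n - 1"
  shows "functional g = coeff g (2 * n - 1)"
proof -
  \<comment> \<open>A real polynomial is determined by its values, so oddness passes to the
    coefficients and removes the even ones. Of the odd moments, only the top one survives.\<close>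
  have "pcompose g [:0, - 1:] = - g"
    unfolding poly_eq_poly_eq_iff[symmetric] by (simp add: fun_eq_iff poly_pcompose odd)
  then have "(- 1) ^ i * coeff g i = - coeff g i" for i
    using coeff_pcompose_linear[of g "- 1" i] by simp
  then have even0: "coeff g i = 0" if "even i" for i
    using that by (metis (no_types) equal_neg_zero mult_1 uminus_power_if power_one)
  have "functional g = (\<Sum>i\<le>2 * n - 1. coeff g i * functional (monom 1 i))"
  proof -
    have "poly g x = (\<Sum>i\<le>2 * n - 1. coeff g i * x ^ i)" for x
      by (subst poly_as_sum_of_monoms'[OF deg, symmetric]) (simp add: poly_sum poly_monom)
    then have "functional g = (\<Sum>c<n. \<Sum>i\<le>2 * n - 1. coeff g i * (weight c * y c ^ i))"
      by (simp add: functional_def sum_distrib_left mult_ac)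
    then show ?thesis
      by (subst (asm) sum.swap) (simp add: functional_def poly_monom sum_distrib_left)
  qed
  also have "\<dots> = (\<Sum>i\<le>2 * n - 1. if i = 2 * n - 1 then coeff g i else 0)"
  proof (intro sum.cong refl)
    fix i assume i: "i \<in> {..2 * n - 1}"
    show "coeff g i * functional (monom 1 i) = (if i = 2 * n - 1 then coeff g i else 0)"
    proof (cases "even i")
      case True
      then show ?thesis using even0[of i] by auto
    next
      case False
      then obtain j where j: "i = 2 * j + 1" by (elim oddE)
      then have "j < n" using i two_le by auto
      then show ?thesis using odd_moment[of j] two_le j by auto
    qed
  qed
  finally show ?thesis by simp
qed

section \<open>Monic orthogonal polynomials of the weight\<close>

fun orth_poly :: "nat \<Rightarrow> real poly" where
  "orth_poly 0 = 1"
| "orth_poly (Suc 0) = [:0, 1:]"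
| "orth_poly (Suc (Suc k)) = [:0, 1:] * orth_poly (Suc k) -
     Polynomial.smult (functional ((orth_poly (Suc k))\<^sup>2) / functional ((orth_poly k)\<^sup>2)) (orth_poly k)"

declare orth_poly.simps(3) [simp del]

lemma monic_orth_poly: "degree (orth_poly k) = k \<and> coeff (orth_poly k) k = 1"
proof (induction k rule: orth_poly.induct)
  case (3 k)
  let ?s = "Polynomial.smult (functional ((orth_poly (Suc k))\<^sup>2) / functional ((orth_poly k)\<^sup>2)) (orth_poly k)"
  have ne: "orth_poly (Suc k) \<noteq> 0" using 3 by auto
  have t: "degree ([:0, 1:] * orth_poly (Suc k)) = Suc (Suc k)"
    using 3 ne by (subst degree_mult_eq) auto
  moreover have "degree ?s < Suc (Suc k)"
    using 3 by (intro le_less_trans[OF degree_smult_le]) simp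
  ultimately have "degree (orth_poly (Suc (Suc k))) = Suc (Suc k)"
    unfolding orth_poly.simps(3) by (metis degree_add_eq_left degree_minus diff_conv_add_uminus)
  moreover have "coeff (orth_poly (Suc (Suc k))) (Suc (Suc k)) = 1"
    unfolding orth_poly.simps(3) using 3 by (simp add: coeff_eq_0)
  ultimately show ?case by blast
qed auto

lemma orth_poly_parity: "poly (orth_poly k) (- x) = (- 1) ^ k * poly (orth_poly k) x"
  by (induction k rule: orth_poly.induct) (auto simp: orth_poly.simps(3) algebra_simps)

definition norm_sq :: "nat \<Rightarrow> real" where
  "norm_sq k = functional ((orth_poly k)\<^sup>2)"

text \<open>A nonzero polynomial of degree below \<open>n\<close> cannot vanish at all
  \<open>n\<close> distinct nodes, and the weights are positive.\<close>

lemma norm_sq_pos: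
  assumes "k < n"
  shows "0 < norm_sq k"
proof -
  have "\<exists>c<n. poly (orth_poly k) (y c) \<noteq> 0"
  proof (rule ccontr)
    assume "\<not> ?thesis"
    then have "orth_poly k = 0"
      using monic_orth_poly[of k] assms inj_nodes
      by (intro poly_eqI_degree[of "y ` {..<n}"]) (auto simp: card_image)
    then show False using monic_orth_poly[of k] by simp
  qed
  then obtain c where "c < n" "poly (orth_poly k) (y c) \<noteq> 0" by blast
  then show ?thesis
    unfolding norm_sq_def functional_def
    by (intro sum_pos2[of _ c]) (auto simp: weight_pos less_imp_le)
qed

text \<open>For \<open>0 < k < n\<close> this is the square of the entry of the Jacobi matrix at
  \<open>(k - 1, k)\<close>. The value 0 at \<open>k = 0\<close> makes \<open>three_term\<close>
  hold there, where \<open>k - 1\<close> truncates to 0.\<close>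

definition off_diag :: "nat \<Rightarrow> real" where
  "off_diag k = (if k = 0 then 0 else norm_sq k / norm_sq (k - 1))"

lemma off_diag_nonneg: "k < n \<Longrightarrow> 0 \<le> off_diag k"
  by (simp add: off_diag_def norm_sq_pos less_imp_le)

lemma three_term:
  "[:0, 1:] * orth_poly k = orth_poly (Suc k) + Polynomial.smult (off_diag k) (orth_poly (k - 1))"
  by (cases k) (auto simp: off_diag_def norm_sq_def orth_poly.simps(3))

text \<open>This is why the recurrence for \<open>orth_poly\<close> has no middle term: the
  integrand is odd of degree below \<open>2 * n - 1\<close>.\<close>

lemma diagonal_vanishes:
  assumes "Suc k < n"
  shows "functional ([:0, 1:] * orth_poly k * orth_poly k) = 0"
proof -
  let ?g = "[:0, 1:] * orth_poly k * orth_poly k"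
  have "degree ?g \<le> 1 + k + k"
    using monic_orth_poly[of k]
    by (intro order.trans[OF degree_mult_le] add_mono) (auto simp del: mult_pCons_left)
  moreover have "poly ?g (- x) = - poly ?g x" for x
    by (simp add: orth_poly_parity power_mult_distrib power_add[symmetric] mult_2[symmetric] del: mult_pCons_left)
  ultimately show ?thesis
    using assms functional_odd[of ?g] by (simp add: coeff_eq_0 del: mult_pCons_left)
qed

text \<open>With \<open>j = Suc m\<close>, the factor t of \<open>orth_poly m\<close> is moved over
  to \<open>orth_poly i\<close> and both products are expanded by \<open>three_term\<close>. For
  \<open>i < m\<close> all indices are then below \<open>j\<close>; for \<open>i = m\<close> the
  diagonal is known to vanish.\<close>

lemma orthogonal:
  assumes "i < j" "j < n"
  shows "functional (orth_poly i * orth_poly j) = 0"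
  using assms
proof (induction j arbitrary: i rule: less_induct)
  case (less j)
  obtain m where j: "j = Suc m" using less.prems by (cases j) auto
  have pm: "orth_poly j = [:0, 1:] * orth_poly m - Polynomial.smult (off_diag m) (orth_poly (m - 1))"
    using three_term[of m] j by simp
  have rec: "functional (orth_poly i * orth_poly j) =
      functional (orth_poly (Suc i) * orth_poly m) + off_diag i * functional (orth_poly (i - 1) * orth_poly m)
      - off_diag m * functional (orth_poly i * orth_poly (m - 1))"
  proof -
    have "orth_poly i * orth_poly j = ([:0, 1:] * orth_poly i) * orth_poly m -
        Polynomial.smult (off_diag m) (orth_poly i * orth_poly (m - 1))"
      unfolding pm by (simp add: right_diff_distrib mult_ac del: mult_pCons_left)
    then show ?thesis
      unfolding three_term[of i] by (simp add: functional_add functional_diff functional_smult distrib_right)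
  qed
  show ?case
  proof (cases "i = m")
    case True
    have a: "functional (orth_poly i * orth_poly j) =
        functional ([:0, 1:] * orth_poly m * orth_poly m) - off_diag m * functional (orth_poly (m - 1) * orth_poly m)"
      unfolding pm True
      by (simp add: right_diff_distrib functional_diff functional_smult mult_ac del: mult_pCons_left)
    \<comment> \<open>For \<open>m = 0\<close> the inner product is not zero, but
      \<open>off_diag 0\<close> is.\<close>
    have "off_diag m * functional (orth_poly (m - 1) * orth_poly m) = 0"
      using less.IH[of m "m - 1"] less.prems j by (cases m) (auto simp: off_diag_def)
    then show ?thesis using a diagonal_vanishes[of m] less.prems j by simp
  next
    case False
    then have im: "i < m" using less.prems j by simp
    have "off_diag i * functional (orth_poly (i - 1) * orth_poly m) = 0"
      using less.IH[of m "i - 1"] im less.prems j by auto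
    \<comment> \<open>If \<open>Suc i = m\<close>, both sides equal \<open>norm_sq m\<close> by the
      choice of \<open>off_diag\<close>; otherwise both vanish by induction.\<close>
    moreover have "functional (orth_poly (Suc i) * orth_poly m) = off_diag m * functional (orth_poly i * orth_poly (m - 1))"
    proof (cases "Suc i = m")
      case True
      then show ?thesis
        using norm_sq_pos[of i] less.prems by (auto simp: off_diag_def norm_sq_def power2_eq_square)
    next
      case False
      then show ?thesis using less.IH[of m "Suc i"] less.IH[of "m - 1" i] im less.prems j by simp
    qed
    ultimately show ?thesis using rec by simp
  qed
qed

lemma orth_poly_inner:
  assumes "i < n" "j < n"
  shows "functional (orth_poly i * orth_poly j) = (if i = j then norm_sq i else 0)"
  using orthogonal[of i j] orthogonal[of j i] assms
  by (cases i j rule: linorder_cases) (auto simp: norm_sq_def power2_eq_square mult.commute)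

text \<open>The odd integrand is now monic of degree exactly \<open>2 * n - 1\<close>, so
  \<open>functional_odd\<close> returns its leading coefficient.\<close>

lemma last_diag: "functional ([:0, 1:] * orth_poly (n - 1) * orth_poly (n - 1)) = 1"
proof -
  let ?p = "orth_poly (n - 1)"
  let ?g = "[:0, 1:] * ?p * ?p"
  have ne: "?p \<noteq> 0" using monic_orth_poly[of "n - 1"] by auto
  have deg: "degree ?g = 2 * n - 1"
    using monic_orth_poly[of "n - 1"] ne two_le by (simp add: degree_mult_eq del: mult_pCons_left)
  have "lead_coeff ?g = 1"
    using monic_orth_poly[of "n - 1"] by (simp add: lead_coeff_mult del: mult_pCons_left)
  moreover have "poly ?g (- x) = - poly ?g x" for x
    by (simp add: orth_poly_parity power_add[symmetric] mult_2[symmetric] del: mult_pCons_left)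
  ultimately show ?thesis
    using functional_odd[of ?g] deg by (simp del: mult_pCons_left)
qed

text \<open>These are the Jacobi entries up to positive factors. In row \<open>n - 1\<close> the
  recurrence would bring in \<open>orth_poly n\<close>, outside the range of
  \<open>orthogonal\<close>, so that row is handled by symmetry and its corner by
  \<open>last_diag\<close>.\<close>

lemma jacobi_entry_nonneg:
  assumes "i < n" "j < n"
  shows "0 \<le> functional ([:0, 1:] * orth_poly i * orth_poly j)"
proof -
  have upper: "0 \<le> functional ([:0, 1:] * orth_poly i * orth_poly j)" if "i < n" "j < n" "i < n - 1" for i j
  proof -
    have "functional ([:0, 1:] * orth_poly i * orth_poly j) =
        functional (orth_poly (Suc i) * orth_poly j) + off_diag i * functional (orth_poly (i - 1) * orth_poly j)"
      unfolding three_term by (simp add: distrib_right functional_add functional_smult)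
    then show ?thesis
      using that by (auto simp: orth_poly_inner off_diag_nonneg norm_sq_pos less_imp_le)
  qed
  show ?thesis
  proof (cases "i < n - 1 \<or> j < n - 1")
    case True
    then show ?thesis using upper[of i j] upper[of j i] assms by (auto simp: mult_ac)
  next
    case False
    then have "i = n - 1" "j = n - 1" using assms by auto
    then show ?thesis using last_diag by simp
  qed
qed

text \<open>Multiplication by t raises the index by at most one, with coefficient 1 on the raised
  term. General \<open>j\<close> serves the induction; the application has
  \<open>j = 0\<close>.\<close>

lemma monom_orth_poly_inner:
  assumes "i + j \<le> k" "k < n"
  shows "functional (monom 1 i * orth_poly j * orth_poly k) = (if i + j = k then norm_sq k else 0)"
  using assms(1)
proof (induction i arbitrary: j)
  case 0
  then show ?case using orth_poly_inner[of j k] assms(2) by (auto simp: monom_0)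
next
  case (Suc i)
  have "monom 1 (Suc i) * orth_poly j * orth_poly k = monom 1 i * ([:0, 1:] * orth_poly j) * orth_poly k"
    by (simp add: monom_Suc mult_ac)
  then have "functional (monom 1 (Suc i) * orth_poly j * orth_poly k) =
      functional (monom 1 i * orth_poly (Suc j) * orth_poly k)
      + off_diag j * functional (monom 1 i * orth_poly (j - 1) * orth_poly k)"
    unfolding three_term by (simp add: distrib_left distrib_right functional_add functional_smult)
  moreover have "i + (j - 1) < k" using Suc.prems by simp
  ultimately show ?case using Suc.IH[of "Suc j"] Suc.IH[of "j - 1"] Suc.prems by simp
qed

section \<open>The Jacobi matrix and its eigenvectors\<close>

definition eigenbasis :: "nat \<Rightarrow> nat \<Rightarrow> real" where
  "eigenbasis k c = sqrt (weight c) * poly (orth_poly k) (y c) / sqrt (norm_sq k)"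

lemma eigenbasis_mult:
  assumes "c < n"
  shows "eigenbasis i c * eigenbasis j c =
    weight c * (poly (orth_poly i) (y c) * poly (orth_poly j) (y c)) / (sqrt (norm_sq i) * sqrt (norm_sq j))"
proof -
  have "sqrt (weight c) * sqrt (weight c) = weight c"
    using weight_pos[OF assms] by simp
  then have "sqrt (weight c) * p * (sqrt (weight c) * q) = weight c * (p * q)" for p q
    by (metis mult.assoc mult.left_commute)
  then show ?thesis by (simp only: eigenbasis_def times_divide_times_eq)
qed

text \<open>For indices below \<open>n\<close>, \<open>g = 1\<close> gives the entries of the
  identity and \<open>g = [:0, 1:]\<close> those of the Jacobi matrix, with column \<open>c\<close>
  as eigenvector for \<open>y c\<close>.\<close>

lemma sum_eigenbasis:
  "(\<Sum>c<n. poly g (y c) * eigenbasis i c * eigenbasis j c) =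
    functional (g * orth_poly i * orth_poly j) / (sqrt (norm_sq i) * sqrt (norm_sq j))"
  unfolding functional_def sum_divide_distrib mult.assoc
  by (intro sum.cong refl) (simp add: eigenbasis_mult mult_ac)

lemma eigenbasis_orthonormal:
  assumes "i < n" "j < n"
  shows "(\<Sum>c<n. eigenbasis i c * eigenbasis j c) = (if i = j then 1 else 0)"
  using sum_eigenbasis[of 1 i j] norm_sq_pos[OF assms(1)] norm_sq_pos[OF assms(2)] by (simp add: orth_poly_inner assms)

text \<open>Up to the positive factor \<open>?s\<close>, which clears the normalising square roots,
  this is the entry \<open>(0, k)\<close> of f at the Jacobi matrix \<open>?J\<close>. Row 0 is
  chosen because \<open>orth_poly 0 = 1\<close>.\<close>

lemma preserver_weighted_sum_nonneg:
  assumes hol: "f holomorphic_on UNIV" and pres: "preserves_nonneg_symmetric n f" and k: "k < n"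
  shows "(\<Sum>c<n. complex_of_real (weight c * poly (orth_poly k) (y c)) * f (of_real (y c))) \<in> \<real>\<^sub>\<ge>\<^sub>0"
proof -
  let ?J = "Matrix.mat n n (\<lambda>(i, j). \<Sum>c<n. y c * eigenbasis i c * eigenbasis j c)"
  let ?U = "\<lambda>k c. complex_of_real (eigenbasis k c)"
  let ?s = "sqrt (norm_sq 0) * sqrt (norm_sq k)"
  have n0: "0 < n" using two_le by simp
  have s: "0 < ?s" using norm_sq_pos[OF n0] norm_sq_pos[OF k] by simp
  have J: "0 \<le> ?J $$ (i, j)" if "i < n" "j < n" for i j
    using that sum_eigenbasis[of "[:0, 1:]" i j] jacobi_entry_nonneg[OF that] norm_sq_pos
    by (simp add: less_imp_le del: mult_pCons_left)
  have "transpose_mat ?J = ?J"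
    by (rule eq_matI) (auto intro!: sum.cong)
  then have ent: "entire_mat f (map_mat complex_of_real ?J) $$ (0, k) \<in> \<real>\<^sub>\<ge>\<^sub>0"
    using pres[unfolded preserves_nonneg_symmetric_def, rule_format, OF _ _ J n0 k] by simp
  have J_complex: "map_mat complex_of_real ?J =
      Matrix.mat n n (\<lambda>(i, j). \<Sum>c<n. complex_of_real (y c) * ?U i c * ?U j c)"
    by (rule eq_matI) auto
  have orth: "(\<Sum>c<n. ?U i c * ?U j c) = (if i = j then 1 else 0)" if "i < n" "j < n" for i j
    using arg_cong[OF eigenbasis_orthonormal[OF that], of complex_of_real] by (simp split: if_splits)
  have "(\<Sum>c<n. ?U 0 c * ?U k c * f (of_real (y c))) \<in> \<real>\<^sub>\<ge>\<^sub>0"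
  proof -
    have "entire_mat f (map_mat complex_of_real ?J) $$ (0, k) = (\<Sum>c<n. ?U 0 c * ?U k c * f (of_real (y c)))"
      unfolding J_complex by (rule entire_mat_spectral[OF hol _ n0 k]) (rule orth)
    with ent show ?thesis by (simp only:)
  qed
  then have nonneg: "of_real ?s * (\<Sum>c<n. ?U 0 c * ?U k c * f (of_real (y c))) \<in> \<real>\<^sub>\<ge>\<^sub>0"
    using s by (intro nonneg_Reals_mult_I) (simp_all add: less_imp_le del: of_real_mult)
  have pointwise: "of_real ?s * (?U 0 c * ?U k c * f (of_real (y c))) =
      complex_of_real (weight c * poly (orth_poly k) (y c)) * f (of_real (y c))" if "c < n" for c
  proof -
    have "?s * (eigenbasis 0 c * eigenbasis k c) = weight c * poly (orth_poly k) (y c)"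
      unfolding eigenbasis_mult[OF that] using s by auto
    from arg_cong[OF this, of complex_of_real] show ?thesis by (simp add: mult.assoc[symmetric])
  qed
  have scaled: "of_real ?s * (\<Sum>c<n. ?U 0 c * ?U k c * f (of_real (y c))) =
      (\<Sum>c<n. complex_of_real (weight c * poly (orth_poly k) (y c)) * f (of_real (y c)))"
    unfolding sum_distrib_left by (intro sum.cong refl pointwise) simp
  show ?thesis using nonneg unfolding scaled .
qed

section \<open>Nonnegative coefficients of the interpolant\<close>

lemma weighted_sum_interpolant:
  assumes "degree P < n" and "\<And>c. c < n \<Longrightarrow> poly P (complex_of_real (y c)) = f (of_real (y c))"
  shows "(\<Sum>c<n. complex_of_real (weight c * poly (orth_poly k) (y c)) * f (of_real (y c))) =
    (\<Sum>i<n. coeff P i * of_real (functional (monom 1 i * orth_poly k)))"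
proof -
  have deg: "degree P \<le> n - 1" and n: "{..n - Suc 0} = {..<n}" using assms(1) by auto
  have P: "f (of_real (y c)) = (\<Sum>i<n. coeff P i * of_real (y c) ^ i)" if "c < n" for c
    unfolding assms(2)[OF that, symmetric]
    by (subst poly_as_sum_of_monoms'[OF deg, symmetric]) (simp add: poly_sum poly_monom n)
  have "(\<Sum>c<n. complex_of_real (weight c * poly (orth_poly k) (y c)) * f (of_real (y c))) =
      (\<Sum>c<n. \<Sum>i<n. coeff P i * of_real (weight c * (y c ^ i * poly (orth_poly k) (y c))))"
    by (intro sum.cong refl) (simp add: P sum_distrib_left mult_ac)
  then show ?thesis
    by (subst (asm) sum.swap) (simp add: functional_def poly_monom sum_distrib_left)
qed

text \<open>In the expansion of the weighted sum, orthogonality removes the coefficients below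
  \<open>k\<close>, and the one at \<open>k\<close> has the positive factor
  \<open>norm_sq k\<close>. For the last two values of \<open>k\<close> nothing above
  \<open>k\<close> contributes either.\<close>

lemma preserver_interpolant_coeffs_nonneg:
  assumes hol: "f holomorphic_on UNIV" and pres: "preserves_nonneg_symmetric n f"
    and P: "degree P < n" "\<And>c. c < n \<Longrightarrow> poly P (complex_of_real (y c)) = f (of_real (y c))"
  shows "coeff P (n - 1) \<in> \<real>\<^sub>\<ge>\<^sub>0" "coeff P (n - 2) \<in> \<real>\<^sub>\<ge>\<^sub>0"
proof -
  have nonneg: "coeff P k \<in> \<real>\<^sub>\<ge>\<^sub>0"
    if k: "k < n" and vanish: "\<And>i. k < i \<Longrightarrow> i < n \<Longrightarrow> functional (monom 1 i * orth_poly k) = 0" for k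
  proof -
    have "functional (monom 1 i * orth_poly k) = (if i = k then norm_sq k else 0)" if "i < n" for i
      using monom_orth_poly_inner[of i 0 k] vanish[of i] k that by (cases "i \<le> k") auto
    then have "(\<Sum>i<n. coeff P i * of_real (functional (monom 1 i * orth_poly k))) =
        (\<Sum>i<n. if i = k then coeff P k * of_real (norm_sq k) else 0)"
      by (intro sum.cong) auto
    then have "coeff P k * of_real (norm_sq k) \<in> \<real>\<^sub>\<ge>\<^sub>0"
      using preserver_weighted_sum_nonneg[OF hol pres k] weighted_sum_interpolant[OF P, of k] k by simp
    then have "coeff P k * of_real (norm_sq k) * of_real (1 / norm_sq k) \<in> \<real>\<^sub>\<ge>\<^sub>0"
      by (rule nonneg_Reals_mult_I) (simp add: norm_sq_pos k less_imp_le del: of_real_divide)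
    moreover have "coeff P k * of_real (norm_sq k) * of_real (1 / norm_sq k) = coeff P k"
      using norm_sq_pos[OF k] by simp
    ultimately show ?thesis by (simp only:)
  qed
  show "coeff P (n - 1) \<in> \<real>\<^sub>\<ge>\<^sub>0" using two_le by (intro nonneg) auto
  show "coeff P (n - 2) \<in> \<real>\<^sub>\<ge>\<^sub>0"
  proof (rule nonneg)
    fix i assume "n - 2 < i" "i < n"
    then have i: "i = Suc (n - 2)" by simp
    \<comment> \<open>The only index above \<open>n - 2\<close> is \<open>n - 1\<close>; the product
      is odd of degree at most \<open>2 * n - 3\<close>, where all odd moments vanish.\<close>
    let ?g = "monom 1 i * orth_poly (n - 2)"
    have "degree ?g \<le> i + (n - 2)"
      using monic_orth_poly[of "n - 2"]
      by (intro order.trans[OF degree_mult_le] add_mono) (auto simp: degree_monom_le)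
    moreover have "poly ?g (- x) = - poly ?g x" for x
    proof -
      have "(- x) ^ i = - ((- 1) ^ (n - 2)) * x ^ i"
        by (subst power_minus) (simp add: i)
      then show ?thesis
        by (simp add: poly_monom orth_poly_parity power_add[symmetric] mult_2[symmetric])
    qed
    ultimately show "functional ?g = 0"
      using two_le i functional_odd[of ?g] by (simp add: coeff_eq_0)
  qed (use two_le in simp)
qed

end

section \<open>The two expressions as coefficients of the interpolant\<close>

theorem theorem22:
  fixes n :: nat and f :: "complex \<Rightarrow> complex" and x :: "nat \<Rightarrow> real"
  assumes "n \<ge> 2"
    and "f holomorphic_on UNIV"
    and "preserves_nonneg_symmetric n f"
    and "\<forall>j\<in>{1..<n}. (-1) ^ (j - 1) * x j > (-1) ^ j * x (Suc j)"
    and "(-1) ^ (n - 1) * x n > 0"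
  shows "divdiff f (map (\<lambda>j. complex_of_real (x j)) [1..<Suc n]) \<in> \<real>\<^sub>\<ge>\<^sub>0
    \<and> (\<forall>k\<in>{1..n}.
         divdiff f (map (\<lambda>j. complex_of_real (x j)) (filter (\<lambda>j. j \<noteq> k) [1..<Suc n]))
           - complex_of_real (\<Sum>j\<in>{1..n} - {k}. x j)
             * divdiff f (map (\<lambda>j. complex_of_real (x j)) [1..<Suc n]) \<in> \<real>\<^sub>\<ge>\<^sub>0)"
proof -
  define y where "y = (\<lambda>c. x (Suc c))"
  interpret alternating_nodes n y
  proof
    show "(- 1) ^ Suc c * y (Suc c) < (- 1) ^ c * y c" if "Suc c < n" for c
      using assms(4)[rule_format, of "Suc c"] that by (simp add: y_def)
  qed (use assms in \<open>auto simp: y_def\<close>)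
  let ?x = "\<lambda>j. complex_of_real (x j)"
  let ?xs = "map ?x [1..<Suc n]"
  have inj: "inj_on ?x {1..n}"
  proof (rule inj_onI)
    fix i j assume ij: "i \<in> {1..n}" "j \<in> {1..n}" "?x i = ?x j"
    then have "i - 1 = j - 1"
      by (intro inj_onD[OF inj_nodes]) (auto simp: y_def)
    then show "i = j" using ij by (auto simp: eq_diff_iff)
  qed
  have set_upt: "set [1..<Suc n] = {1..n}" by auto
  have dist: "distinct ?xs"
    unfolding distinct_map set_upt using inj by simp
  obtain P where P: "degree P < length ?xs" "\<forall>z\<in>set ?xs. poly P z = f z"
    using interpolation_exists[OF dist, of f] assms(1) by auto
  have top: "divdiff f ?xs = coeff P (n - 1)"
    using divdiff_eq_coeff[OF dist _ P] assms(1) by simp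
  have "poly P (of_real (y c)) = f (of_real (y c))" if "c < n" for c
    using P(2) that unfolding y_def by (simp add: set_upt del: upt_Suc)
  then have coeffs: "coeff P (n - 1) \<in> \<real>\<^sub>\<ge>\<^sub>0" "coeff P (n - 2) \<in> \<real>\<^sub>\<ge>\<^sub>0"
    using preserver_interpolant_coeffs_nonneg[OF assms(2,3), of P] P(1) by (simp_all del: upt_Suc)
  \<comment> \<open>Without point \<open>k\<close>, the reduced interpolant has top coefficient
    \<open>coeff P (n - 2)\<close> plus \<open>coeff P (n - 1)\<close> times the sum of the
    remaining points. The subtracted term cancels the second part, so the value is the same for
    every \<open>k\<close>.\<close>
  have "divdiff f (map ?x (filter (\<lambda>j. j \<noteq> k) [1..<Suc n]))
      - of_real (\<Sum>j\<in>{1..n} - {k}. x j) * divdiff f ?xs = coeff P (n - 2)" if k: "k \<in> {1..n}" for k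
  proof -
    let ?is = "filter (\<lambda>j. j \<noteq> k) [1..<Suc n]"
    have set_is: "set ?is = {1..n} - {k}" by auto
    have "distinct ?is" by simp
    then have "length ?is = card ({1..n} - {k})"
      using distinct_card[of ?is] set_is by simp
    then have len: "length (map ?x ?is) = n - 1" using k by simp
    have "0 < length (map ?x ?is)" using len assms(1) by linarith
    then have ne: "map ?x ?is \<noteq> []" by (rule length_greater_0_conv[THEN iffD1])
    have dist_is: "distinct (map ?x ?is)"
      unfolding distinct_map set_is using inj by (auto intro: inj_on_subset)
    have "\<forall>z\<in>set (map ?x ?is). poly P z = f z" using P(2) by auto
    moreover have "degree P \<le> length (map ?x ?is)" using P(1) len by (simp del: upt_Suc)
    ultimately obtain R where R: "degree R < length (map ?x ?is)" "\<forall>z\<in>set (map ?x ?is). poly R z = f z"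
      "coeff R (length (map ?x ?is) - 1) = coeff P (length (map ?x ?is) - 1)
         + coeff P (length (map ?x ?is)) * sum_list (map ?x ?is)"
      using divide_by_root_poly[OF ne] by blast
    have "sum_list (map ?x ?is) = of_real (\<Sum>j\<in>{1..n} - {k}. x j)"
      using sum_list_distinct_conv_sum_set[OF \<open>distinct ?is\<close>, of ?x] unfolding set_is by simp
    then show ?thesis
      using divdiff_eq_coeff[OF dist_is ne R(1,2)] R(3) len top
      by (simp add: mult.commute numeral_2_eq_2 del: upt_Suc)
  qed
  then show ?thesis using top coeffs by simp
qed

end
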